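(* Let $b^{\ast}>0$, let $I\subset[0,b^{\ast}]$ be an interval with interior $I^{\circ}$, and let $f:I\to\mathbb{R}$ be a twice differentiable mapping on $I^{\circ}$ such that $f''\in L[a,b]$, where $a,b\in I$ with $a<b$. If $|f''|^{q}$ is $(\alpha,m)$-convex on $[a,b]$ for $(\alpha,m)\in[0,1]^2$, and for some fixed $q\ge1$, then the following inequality holds: $$\left|\frac{f(a)+f(mb)}{2}-\frac{1}{mb-a}\int_{a}^{mb}f(x)\,dx\right|\le\frac{(mb-a)^2}{2}\left(\frac12\right)^{1-\frac1q}\left(|f''(a)|^{q}\beta(\alpha+2,q+1)+m|f''(b)|^{q}\left(\frac{1}{(q+1)(q+2)}-\beta(\alpha+2,q+1)\right)\right)^{\frac1q}.$$
   Context: $\beta(x,y)=\int_0^1 t^{x-1}(1-t)^{y-1}\,dt$, $x,y>0$, is the Beta function, and $L[a,b]$ denotes the space of integrable functions on $[a,b]$. For $(\alpha,m)\in[0,1]^2$, a function $g:[0,b]\to\mathbb{R}$ is said to be $(\alpha,m)$-convex if $g(tx+m(1-t)y)\le t^{\alpha}g(x)+m(1-t^{\alpha})g(y)$ for every $x,y\in[0,b]$ and $t\in[0,1]$; "$(\alpha,m)$-convex on $[a,b]$" refers to the same inequality with $x,y\in[a,b]$ and $t\in[0,1]$. *)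

theory Defs
  imports "HOL-Analysis.Analysis"
begin

(* Real power on [0,1] with the convention 0^0 = 1 (the library has 0 powr 0 = 0).
   With it, the (0,0)-convex functions are those with g (t*x) <= g x for all t in [0,1],
   t = 0 included. *)
definition rpow :: "real \<Rightarrow> real \<Rightarrow> real" where
  "rpow t \<alpha> = (if \<alpha> = 0 then 1 else t powr \<alpha>)"

(* x and y range over S, but the point t*x + m*(1-t)*y may lie outside S;
   for S = {a..b} with 0 <= a it ranges over {m*a..b}. *)
definition am_convex_on :: "real \<Rightarrow> real \<Rightarrow> real set \<Rightarrow> (real \<Rightarrow> real) \<Rightarrow> bool" where
  "am_convex_on \<alpha> m S g \<longleftrightarrow>
     (\<forall>x\<in>S. \<forall>y\<in>S. \<forall>t\<in>{0..1}.
        g (t * x + m * (1 - t) * y) \<le> rpow t \<alpha> * g x + m * (1 - rpow t \<alpha>) * g y)"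

end

theory Submission
  imports Defs
begin

text \<open>
  Put \<open>c = m * b\<close>. Integrating by parts twice along the segment from \<open>c\<close> to \<open>a\<close> turns the error
  of the trapezoidal rule into a weighted mean of the second derivative,
  \[ \frac{f(a)+f(c)}2 - \frac1{c-a}\int_a^c f
     = \frac{(c-a)^2}2 \int_0^1 t\,(1-t)\,f''(ta+(1-t)c)\,dt \]
  (lemma \<open>has_integral_trapezoid_error\<close>). The factor \<open>t\<close> is then kept as a weight of total mass
  \<open>1/2\<close>, while \<open>1 - t\<close> joins the integrand, and the power mean inequality bounds the integral by
  \[ \Big(\frac12\Big)^{1-1/q} \Big(\int_0^1 t\,(1-t)^q\,|f''(ta+(1-t)c)|^q\,dt\Big)^{1/q}. \]
  Since \<open>ta + (1-t)c = ta + m(1-t)b\<close>, the convexity hypothesis at the points \<open>a\<close> and \<open>b\<close> bounds the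
  last factor by \<open>t\<^sup>\<alpha> |f'' a|\<^sup>q + m (1 - t\<^sup>\<alpha>) |f'' b|\<^sup>q\<close>, and what remains are
  Beta integrals (lemma \<open>has_integral_rpow_moment\<close>).

  The two bounds are merged into lemma \<open>weighted_power_mean_bound\<close>, which integrates the explicit
  majorant in place of \<open>|f''|\<^sup>q\<close>. This matters when \<open>m * b < a\<close>: the segment then leaves \<open>[a, b]\<close>,
  but the identity holds for either order of the two end points, and the convexity inequality
  controls \<open>f''\<close> on the whole segment.
\<close>

text \<open>
  The integrand is an exact derivative: with \<open>d = c - a\<close>, \<open>x(t) = ta + (1-t)c\<close> and an antiderivative
  \<open>F\<close> of \<open>f\<close>, two integrations by parts lead to the primitive
  \<open>- t(1-t) f'(x)/d - (1-2t) f(x)/d\<^sup>2 + 2 F(x)/d\<^sup>3\<close>. Hence the fundamental theorem of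
  calculus for the Henstock--Kurzweil integral applies to any second derivative, for either sign
  of \<open>d\<close>.
\<close>
lemma has_integral_trapezoid_error:
  fixes f f' f'' :: "real \<Rightarrow> real" and a c :: real
  assumes ne: "a \<noteq> c"
    and f': "\<And>x. x \<in> closed_segment a c \<Longrightarrow>
               (f has_real_derivative f' x) (at x within closed_segment a c)"
    and f'': "\<And>x. x \<in> closed_segment a c \<Longrightarrow>
               (f' has_real_derivative f'' x) (at x within closed_segment a c)"
  shows "((\<lambda>t. t * (1 - t) * f'' (t * a + (1 - t) * c)) has_integral
           2 / (c - a)\<^sup>2 * ((f a + f c) / 2 - 1 / (c - a) * (LBINT x=a..c. f x))) {0..1}"
proof -
  define S where "S = closed_segment a c"
  have S_eq: "S = {min a c..max a c}"
    by (auto simp: S_def closed_segment_eq_real_ivl)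
  have contf: "continuous_on S f"
    using f' unfolding S_def by (metis DERIV_continuous_on)
  obtain F where F: "\<And>x. x \<in> S \<Longrightarrow> (F has_vector_derivative f x) (at x within S)"
    using antiderivative_continuous contf unfolding S_eq by metis
  have int_f: "(LBINT x=a..c. f x) = F c - F a"
    using interval_integral_FTC_finite[of a c f F] contf F unfolding S_eq by auto
  define x where "x t = t * a + (1 - t) * c" for t
  have x_S: "x t \<in> S" if "t \<in> {0..1}" for t
  proof -
    have "x t = (1 - t) * c + t * a" by (simp add: x_def)
    then show ?thesis
      unfolding S_def closed_segment_commute[of a c] using that
      by (auto simp: in_segment)
  qed
  have x': "(x has_real_derivative a - c) (at t within {0..1})" for t
    unfolding x_def by (auto intro!: derivative_eq_intros)
  have chain: "((\<lambda>t. g (x t)) has_real_derivative g' (x t) * (a - c)) (at t within {0..1})"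
    if "\<And>y. y \<in> S \<Longrightarrow> (g has_real_derivative g' y) (at y within S)" "t \<in> {0..1}" for g g' t
  proof -
    have "(g has_real_derivative g' (x t)) (at (x t) within x ` {0..1})"
      using that x_S by (meson has_field_derivative_subset image_subsetI)
    from DERIV_image_chain[OF this x'] show ?thesis by (simp add: o_def)
  qed
  define d where "d = c - a"
  have d: "d \<noteq> 0" "a - c = - d" using ne by (auto simp: d_def)
  define H where "H t = (- 1 / d) * (t * (1 - t) * f' (x t)) - (1 / d\<^sup>2) * ((1 - 2 * t) * f (x t))
      + (2 / d ^ 3) * F (x t)" for t
  have "(H has_vector_derivative t * (1 - t) * f'' (x t)) (at t within {0..1})"
    if t: "t \<in> {0..1}" for t
  proof -
    have 1: "((\<lambda>t. f (x t)) has_real_derivative f' (x t) * - d) (at t within {0..1})"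
      using chain[of f f'] f' t d unfolding S_def by simp
    have 2: "((\<lambda>t. f' (x t)) has_real_derivative f'' (x t) * - d) (at t within {0..1})"
      using chain[of f' f''] f'' t d unfolding S_def by simp
    have 3: "((\<lambda>t. F (x t)) has_real_derivative f (x t) * - d) (at t within {0..1})"
      using chain[of F f] F t d by (simp add: has_real_derivative_iff_has_vector_derivative)
    have u: "((\<lambda>t. t * (1 - t) * f' (x t)) has_real_derivative
               (1 - 2 * t) * f' (x t) - d * (t * (1 - t) * f'' (x t))) (at t within {0..1})"
      by (auto intro!: derivative_eq_intros 2 simp: algebra_simps)
    have v: "((\<lambda>t. (1 - 2 * t) * f (x t)) has_real_derivative
               - 2 * f (x t) - d * ((1 - 2 * t) * f' (x t))) (at t within {0..1})"
      by (auto intro!: derivative_eq_intros 1 simp: algebra_simps)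
    have "(H has_real_derivative t * (1 - t) * f'' (x t)) (at t within {0..1})"
      unfolding H_def
    proof (rule DERIV_cong[OF DERIV_add[OF DERIV_diff[OF DERIV_cmult[OF u] DERIV_cmult[OF v]] DERIV_cmult[OF 3]]])
      show "(- 1 / d) * ((1 - 2 * t) * f' (x t) - d * (t * (1 - t) * f'' (x t)))
            - (1 / d\<^sup>2) * (- 2 * f (x t) - d * ((1 - 2 * t) * f' (x t)))
            + (2 / d ^ 3) * (f (x t) * - d) = t * (1 - t) * f'' (x t)"
        using d(1) by (simp add: field_simps power2_eq_square power3_eq_cube)
    qed
    then show ?thesis by (simp add: has_real_derivative_iff_has_vector_derivative)
  qed
  then have "((\<lambda>t. t * (1 - t) * f'' (x t)) has_integral H 1 - H 0) {0..1}"
    by (intro fundamental_theorem_of_calculus) auto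
  moreover have "H 1 - H 0 = 2 / d\<^sup>2 * ((f a + f c) / 2 - 1 / d * (F c - F a))"
    using d(1) unfolding H_def x_def by (simp add: field_simps power2_eq_square power3_eq_cube)
  ultimately show ?thesis by (simp add: int_f x_def d_def)
qed

text \<open>
  The tangent to \<open>y \<mapsto> y powr (1/q)\<close> at \<open>M powr q\<close> lies above this concave function. This is the
  pointwise inequality behind the power mean inequality: its right-hand side is affine in
  \<open>v powr q\<close> and can be integrated term by term.
\<close>
lemma Youngs_tangent:
  fixes v M q :: real
  assumes "v \<ge> 0" "M > 0" "q \<ge> 1"
  shows "v \<le> v powr q * M powr (1 - q) / q + (1 - 1 / q) * M"
proof (cases "v = 0")
  case True
  then show ?thesis using assms by simp
next
  case False
  with \<open>v \<ge> 0\<close> have "v > 0" by simp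
  have "(v powr q * M powr (1 - q)) powr (1 / q) * M powr (1 - 1 / q)
      = v * (M powr ((1 - q) / q) * M powr (1 - 1 / q))"
    using \<open>v > 0\<close> assms by (simp add: powr_mult powr_powr)
  also have "M powr ((1 - q) / q) * M powr (1 - 1 / q) = M powr ((1 - q) / q + (1 - 1 / q))"
    by (rule powr_add[symmetric])
  also have "(1 - q) / q + (1 - 1 / q) = 0"
    using assms by (simp add: diff_divide_distrib)
  finally have "v = (v powr q * M powr (1 - q)) powr (1 / q) * M powr (1 - 1 / q)"
    using assms by simp
  also have "\<dots> \<le> 1 / q * (v powr q * M powr (1 - q)) + (1 - 1 / q) * M"
    using \<open>v > 0\<close> assms by (intro Youngs_inequality_0) auto
  finally show ?thesis by simp
qed

text \<open>
  The power mean inequality for the weight \<open>p\<close>, with the \<open>q\<close>-th power of the integrand replaced by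
  a majorant \<open>w\<close>. Integrating the tangent inequality gives
  \<open>|J| \<le> K M\<^sup>1\<^sup>-\<^sup>q / q + (1 - 1/q) M P\<close> for every \<open>M > 0\<close>, and \<open>M = (K/P)\<^sup>1\<^sup>/\<^sup>q\<close>
  minimizes the right-hand side. As Henstock--Kurzweil integrals can be compared pointwise, the
  integrals that occur are those of \<open>p g\<close>, \<open>p w\<close> and \<open>p\<close>.
\<close>
lemma weighted_power_mean_bound:
  fixes p g w :: "real \<Rightarrow> real" and J K P q :: real
  assumes J: "((\<lambda>t. p t * g t) has_integral J) S"
    and K: "((\<lambda>t. p t * w t) has_integral K) S"
    and P: "(p has_integral P) S"
    and p: "\<And>t. t \<in> S \<Longrightarrow> p t \<ge> 0"
    and w: "\<And>t. t \<in> S \<Longrightarrow> \<bar>g t\<bar> powr q \<le> w t"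
    and "P > 0" "q \<ge> 1"
  shows "\<bar>J\<bar> \<le> P powr (1 - 1 / q) * K powr (1 / q)"
proof -
  have bound: "\<bar>J\<bar> \<le> K * M powr (1 - q) / q + (1 - 1 / q) * M * P" if "M > 0" for M
  proof -
    have R: "((\<lambda>t. p t * w t * (M powr (1 - q) / q) + p t * ((1 - 1 / q) * M)) has_integral
            K * (M powr (1 - q) / q) + P * ((1 - 1 / q) * M)) S"
      by (intro has_integral_add has_integral_mult_left J K P)
    have "norm (p t * g t) \<le> p t * w t * (M powr (1 - q) / q) + p t * ((1 - 1 / q) * M)"
      if t: "t \<in> S" for t
    proof -
      have "\<bar>g t\<bar> \<le> \<bar>g t\<bar> powr q * M powr (1 - q) / q + (1 - 1 / q) * M"
        using Youngs_tangent \<open>M > 0\<close> \<open>q \<ge> 1\<close> by simp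
      also have "\<dots> \<le> w t * M powr (1 - q) / q + (1 - 1 / q) * M"
        using w[OF t] \<open>q \<ge> 1\<close> by (intro add_right_mono divide_right_mono mult_right_mono) auto
      finally have "p t * \<bar>g t\<bar> \<le> p t * (w t * M powr (1 - q) / q + (1 - 1 / q) * M)"
        using p[OF t] by (rule mult_left_mono)
      then show ?thesis using p[OF t] by (simp add: abs_mult algebra_simps)
    qed
    then have "norm J \<le> K * (M powr (1 - q) / q) + P * ((1 - 1 / q) * M)"
      using Henstock_Kurzweil_Integration.integral_norm_bound_integral[OF
          has_integral_integrable[OF J] has_integral_integrable[OF R]]
      unfolding integral_unique[OF J] integral_unique[OF R] by blast
    then show ?thesis by (simp add: algebra_simps)
  qed
  have w0: "w t \<ge> 0" if "t \<in> S" for t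
    using w[OF that] by (meson order_trans powr_ge_zero)
  have "K \<ge> 0"
    using has_integral_nonneg[OF K] p w0 by simp
  show ?thesis
  proof (cases "K = 0")
    case True
    \<comment> \<open>The optimal \<open>M\<close> would be \<open>0\<close>, so it is approached in the limit.\<close>
    have "\<bar>J\<bar> \<le> 0 + e" if "e > 0" for e
    proof -
      have "\<bar>J\<bar> \<le> (1 - 1 / q) * (e / P) * P"
        using bound[of "e / P"] that \<open>P > 0\<close> True by simp
      also have "\<dots> = (1 - 1 / q) * e" using \<open>P > 0\<close> by simp
      also have "\<dots> \<le> 1 * e" using that \<open>q \<ge> 1\<close> by (intro mult_right_mono) auto
      finally show ?thesis by simp
    qed
    then have "\<bar>J\<bar> \<le> 0" by (rule field_le_epsilon)
    then show ?thesis using True by simp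
  next
    case False
    with \<open>K \<ge> 0\<close> have "K > 0" by simp
    define M where "M = (K / P) powr (1 / q)"
    have "M > 0" using \<open>K > 0\<close> \<open>P > 0\<close> by (simp add: M_def)
    have "M powr q = K / P"
      using \<open>K > 0\<close> \<open>P > 0\<close> \<open>q \<ge> 1\<close> by (simp add: M_def powr_powr)
    then have "K * M powr (1 - q) = M * P"
      using \<open>M > 0\<close> \<open>P > 0\<close> by (simp add: powr_diff field_simps)
    then have "\<bar>J\<bar> \<le> M * P / q + (1 - 1 / q) * M * P"
      using bound[OF \<open>M > 0\<close>] by simp
    also have "\<dots> = M * P" using \<open>q \<ge> 1\<close> by (simp add: field_simps)
    also have "\<dots> = P powr (1 - 1 / q) * K powr (1 / q)"
      using \<open>K > 0\<close> \<open>P > 0\<close> by (simp add: M_def powr_divide powr_diff)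
    finally show ?thesis .
  qed
qed

lemma Beta_2_real:
  fixes q :: real
  assumes "q > 0"
  shows "Beta 2 (q + 1) = 1 / ((q + 1) * (q + 2))"
proof -
  have "Gamma (q + 3) = (q + 2) * ((q + 1) * Gamma (q + 1))"
    using assms Gamma_plus1[of "q + 2"] Gamma_plus1[of "q + 1"]
    by (auto simp: add_ac nonpos_Ints_def)
  moreover have "Gamma (q + 1) > 0" using assms by (simp add: Gamma_real_pos)
  moreover have "Gamma (2::real) = 1" using Gamma_fact[of 1, where 'a = real] by simp
  ultimately show ?thesis by (simp add: Beta_def add_ac)
qed

text \<open>
  The convention \<open>rpow 0 0 = 1\<close> does no harm to the Beta integral: the extra factor \<open>t\<close> makes both
  integrands vanish at \<open>t = 0\<close>. So \<open>\<alpha> = 0\<close> is included and yields the integral of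
  \<open>t * (1 - t) powr q\<close>.
\<close>
lemma has_integral_rpow_moment:
  assumes "\<alpha> \<ge> 0" "q > 0"
  shows "((\<lambda>t. t * ((1 - t) powr q * rpow t \<alpha>)) has_integral Beta (\<alpha> + 2) (q + 1)) {0..1}"
proof -
  have "((\<lambda>t. t powr (\<alpha> + 2 - 1) * (1 - t) powr (q + 1 - 1)) has_integral Beta (\<alpha> + 2) (q + 1)) {0..1}"
    using assms by (intro has_integral_Beta_real) auto
  moreover have "t powr (\<alpha> + 2 - 1) * (1 - t) powr (q + 1 - 1) = t * ((1 - t) powr q * rpow t \<alpha>)"
    if "t \<in> {0..1}" for t :: real
    using that by (cases "t = 0") (auto simp: rpow_def powr_add)
  ultimately show ?thesis
    by (metis (no_types, lifting) has_integral_cong)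
qed

theorem theorem6:
  fixes f f' f'' :: "real \<Rightarrow> real" and I :: "real set" and a b bstar \<alpha> m q :: real
  assumes "bstar > 0" and "is_interval I" and "I \<subseteq> {0..bstar}"
    and "a \<in> I" and "b \<in> I" and "a < b"
    and "\<And>x. x \<in> interior I \<Longrightarrow> (f has_real_derivative f' x) (at x)"
    and "\<And>x. x \<in> interior I \<Longrightarrow> (f' has_real_derivative f'' x) (at x)"
    and "m * b \<in> I" and "m * b \<noteq> a"
    and "\<And>x. x \<in> {a, b, m * b} \<Longrightarrow> (f has_real_derivative f' x) (at x within I)"
    and "\<And>x. x \<in> {a, b, m * b} \<Longrightarrow> (f' has_real_derivative f'' x) (at x within I)"
    and "f'' absolutely_integrable_on {a..b}"
    and "\<alpha> \<in> {0..1}" and "m \<in> {0..1}" and "q \<ge> 1"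
    and "am_convex_on \<alpha> m {a..b} (\<lambda>x. \<bar>f'' x\<bar> powr q)"
  shows "\<bar>(f a + f (m * b)) / 2 - 1 / (m * b - a) * (LBINT x=a..m * b. f x)\<bar>
      \<le> (m * b - a)\<^sup>2 / 2 * (1 / 2) powr (1 - 1 / q) *
        (\<bar>f'' a\<bar> powr q * Beta (\<alpha> + 2) (q + 1)
         + m * \<bar>f'' b\<bar> powr q * (1 / ((q + 1) * (q + 2)) - Beta (\<alpha> + 2) (q + 1))) powr (1 / q)"
proof -
  define c where "c = m * b"
  have "c \<in> I" "a \<noteq> c" using assms by (auto simp: c_def)
  let ?S = "closed_segment a c"
  have sub: "?S \<subseteq> I"
    using \<open>is_interval I\<close> \<open>a \<in> I\<close> \<open>c \<in> I\<close>
    by (simp add: closed_segment_subset is_interval_convex)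
  have int_sub: "x \<in> interior I" if "x \<in> ?S" "x \<notin> {a, b, c}" for x
  proof -
    have "x \<in> open_segment a c" using that by (auto simp: open_segment_def)
    moreover have "open (open_segment a c)"
      by (auto simp: open_segment_eq_real_ivl)
    ultimately show ?thesis
      using sub segment_open_subset_closed by (metis interiorI subset_trans)
  qed
  have seg: "(g has_real_derivative g' x) (at x within ?S)"
    if "\<And>x. x \<in> interior I \<Longrightarrow> (g has_real_derivative g' x) (at x)"
      "\<And>x. x \<in> {a, b, c} \<Longrightarrow> (g has_real_derivative g' x) (at x within I)"
      "x \<in> ?S" for g g' x
    using that sub int_sub by (meson has_field_derivative_at_within has_field_derivative_subset)
  define \<phi> where "\<phi> t = f'' (t * a + (1 - t) * c)" for t
  define E where "E = (f a + f c) / 2 - 1 / (c - a) * (LBINT x=a..c. f x)"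
  define K where "K = \<bar>f'' a\<bar> powr q * Beta (\<alpha> + 2) (q + 1)
         + m * \<bar>f'' b\<bar> powr q * (1 / ((q + 1) * (q + 2)) - Beta (\<alpha> + 2) (q + 1))"
  define w where "w t = rpow t \<alpha> * \<bar>f'' a\<bar> powr q + m * (1 - rpow t \<alpha>) * \<bar>f'' b\<bar> powr q" for t
  \<comment> \<open>The grouping splits \<open>t * (1 - t)\<close> into the weight \<open>t\<close> and a factor of the integrand; weighting
      with the whole product would lead to other constants.\<close>
  have err: "((\<lambda>t. t * ((1 - t) * \<phi> t)) has_integral 2 / (c - a)\<^sup>2 * E) {0..1}"
    using has_integral_trapezoid_error[OF \<open>a \<noteq> c\<close> seg[of f f'] seg[of f' f'']] assms
    unfolding E_def \<phi>_def c_def by (simp add: mult.assoc)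
  have conv: "\<bar>\<phi> t\<bar> powr q \<le> w t" if "t \<in> {0..1}" for t
  proof -
    have "\<phi> t = f'' (t * a + m * (1 - t) * b)"
      by (simp add: \<phi>_def c_def ac_simps)
    moreover have "\<bar>f'' (t * a + m * (1 - t) * b)\<bar> powr q \<le> w t"
      using assms(17) \<open>a < b\<close> that unfolding am_convex_on_def w_def by force
    ultimately show ?thesis by simp
  qed
  have dom: "\<bar>(1 - t) * \<phi> t\<bar> powr q \<le> (1 - t) powr q * w t" if "t \<in> {0..1}" for t
    using conv[OF that] that by (auto simp: abs_mult powr_mult intro!: mult_left_mono)
  have mom\<alpha>: "((\<lambda>t. t * ((1 - t) powr q * rpow t \<alpha>)) has_integral Beta (\<alpha> + 2) (q + 1)) {0..1}"
    using assms by (intro has_integral_rpow_moment) auto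
  have mom0: "((\<lambda>t. t * (1 - t) powr q) has_integral 1 / ((q + 1) * (q + 2))) {0..1}"
    using has_integral_rpow_moment[of 0 q] Beta_2_real[of q] \<open>q \<ge> 1\<close> by (simp add: rpow_def)
  have K: "((\<lambda>t. t * ((1 - t) powr q * w t)) has_integral K) {0..1}"
    using has_integral_add[OF has_integral_mult_left[OF mom\<alpha>, of "\<bar>f'' a\<bar> powr q"]
        has_integral_mult_left[OF has_integral_diff[OF mom0 mom\<alpha>], of "m * \<bar>f'' b\<bar> powr q"]]
    unfolding w_def K_def by (simp add: algebra_simps)
  have half: "((\<lambda>t. t) has_integral (1 / 2 :: real)) {0..1}"
    using ident_has_integral[of 0 "1::real"] by simp
  have "\<bar>2 / (c - a)\<^sup>2 * E\<bar> \<le> (1 / 2) powr (1 - 1 / q) * K powr (1 / q)"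
    using err K half dom \<open>q \<ge> 1\<close> by (intro weighted_power_mean_bound) auto
  then have "\<bar>E\<bar> \<le> (c - a)\<^sup>2 / 2 * ((1 / 2) powr (1 - 1 / q) * K powr (1 / q))"
    using \<open>a \<noteq> c\<close> by (simp add: abs_mult field_simps)
  then show ?thesis unfolding E_def K_def c_def by (simp add: mult.assoc)
qed

end
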